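(* There exists a constant $C>0$ such that for all sufficiently large $n$, $M_{2,5}(n) > C n^{3/2}$.
   Context: For a finite set $S \subset \mathbb{R}^d$, the Vietoris–Rips complex $R(S)$ is the simplicial complex on vertex set $S$ whose faces are all subsets of $S$ of (Euclidean) diameter at most $1$. For a fixed field $\mathbf{k}$, $\tilde{\beta}_p(\Gamma)=\dim_{\mathbf{k}}\tilde{H}_p(\Gamma;\mathbf{k})$ denotes the $p$-th reduced Betti number. Define $M_{p,d}(n) := \max\{\tilde{\beta}_p(R(S)) : S \subset \mathbb{R}^d,\ |S| \leq n\}$. *)

theory Defs
  imports "Jordan_Normal_Form.Missing_VectorSpace" "HOL-Analysis.Analysis"
begin

hide_const (open) Multiset.mult Polynomial.smult

text \<open>
  An abstract simplicial complex is the set \<open>K\<close> of its faces, with the empty face included; the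
  empty face spans the chains in degree \<open>-1\<close>, so that the homology below is reduced homology.
\<close>

definition rips_complex :: "'a::metric_space set \<Rightarrow> 'a set set" where
  "rips_complex S = {\<sigma>. \<sigma> \<subseteq> S \<and> diameter \<sigma> \<le> 1}"

text \<open>
  Oriented simplicial chains with coefficients in a field: an oriented simplex is given by an
  ordering \<open>xs\<close> of the vertices of a face, and exchanging two vertices reverses the orientation, so
  a chain is a function on such lists that changes sign under adjacent transpositions.
  The index \<open>m\<close> is the number of vertices, i.e. the dimension plus one.
\<close>

definition oriented_chains :: "'v set set \<Rightarrow> nat \<Rightarrow> ('v list \<Rightarrow> 'k::field) set" where
  "oriented_chains K m = {c.
     (\<forall>xs. c xs \<noteq> 0 \<longrightarrow> length xs = m \<and> distinct xs \<and> set xs \<in> K) \<and>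
     (\<forall>xs a b ys. c (xs @ a # b # ys) = - c (xs @ b # a # ys))}"

text \<open>
  The usual boundary \<open>\<Sum>i. (-1)^i [v\<^sub>0, \<dots>, v\<^sub>i omitted, \<dots>, v\<^sub>p]\<close> of an oriented simplex, extended
  linearly: a coface of \<open>xs\<close> obtained by adding a vertex \<open>v\<close> can be oriented as \<open>v # xs\<close>, and \<open>xs\<close>
  then occurs in its boundary with sign \<open>+1\<close> (see \<open>boundary_simplex\<close> below).
\<close>

definition boundary :: "'v set set \<Rightarrow> ('v list \<Rightarrow> 'k::field) \<Rightarrow> 'v list \<Rightarrow> 'k" where
  "boundary K c = (\<lambda>xs. \<Sum>v\<in>\<Union>K. c (v # xs))"

definition cycles :: "'v set set \<Rightarrow> nat \<Rightarrow> ('v list \<Rightarrow> 'k::field) set" where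
  "cycles K p = {c \<in> oriented_chains K (p + 1). boundary K c = (\<lambda>xs. 0)}"

definition boundaries :: "'v set set \<Rightarrow> nat \<Rightarrow> ('v list \<Rightarrow> 'k::field) set" where
  "boundaries K p = boundary K ` oriented_chains K (p + 2)"

definition homology_class :: "'v set set \<Rightarrow> nat \<Rightarrow> ('v list \<Rightarrow> 'k::field) \<Rightarrow> ('v list \<Rightarrow> 'k) set" where
  "homology_class K p z = {\<lambda>xs. z xs + b xs | b. b \<in> boundaries K p}"

text \<open>The vector space of cosets \<open>cycles K p / boundaries K p\<close>; the ring fields of the record play no
  role.\<close>

definition reduced_homology :: "'v set set \<Rightarrow> nat \<Rightarrow> ('k::field, ('v list \<Rightarrow> 'k) set) module" where
  "reduced_homology K p =
     \<lparr>carrier = homology_class K p ` cycles K p,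
      mult = undefined, one = undefined,
      zero = boundaries K p,
      add = (\<lambda>X Y. {\<lambda>xs. x xs + y xs | x y. x \<in> X \<and> y \<in> Y}),
      smult = (\<lambda>a X. {\<lambda>xs. a * x xs + b xs | x b. x \<in> X \<and> b \<in> boundaries K p})\<rparr>"

abbreviation coeff_field :: "'k::field ring" where
  "coeff_field \<equiv> \<lparr>carrier = UNIV, mult = (*), one = 1, zero = 0, add = (+)\<rparr>"

definition reduced_betti :: "'k::field itself \<Rightarrow> nat \<Rightarrow> 'v set set \<Rightarrow> nat" where
  "reduced_betti _ p K =
     vectorspace.dim (coeff_field :: 'k ring) (reduced_homology K p :: ('k, ('v list \<Rightarrow> 'k) set) module)"

definition max_rips_betti :: "'k::field itself \<Rightarrow> 'd::finite itself \<Rightarrow> nat \<Rightarrow> nat \<Rightarrow> nat" where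
  "max_rips_betti k _ p n =
     Max {reduced_betti k p (rips_complex S) | S :: (real ^ 'd) set. finite S \<and> card S \<le> n}"

lemma chains_swap: "c \<in> oriented_chains K m \<Longrightarrow> c (xs @ a # b # ys) = - c (xs @ b # a # ys)"
  unfolding oriented_chains_def by blast

lemma chains_insert_sign:
  assumes "c \<in> oriented_chains K m" and "i \<le> length xs"
  shows "c (take i xs @ v # drop i xs) = (-1) ^ i * c (v # xs)"
  using assms(2)
proof (induction i)
  case (Suc i)
  from Suc.prems have "take (Suc i) xs = take i xs @ [xs ! i]" "drop i xs = xs ! i # drop (Suc i) xs"
    by (simp_all add: take_Suc_conv_app_nth Cons_nth_drop_Suc)
  then show ?case
    using Suc chains_swap[OF assms(1), of "take i xs" "xs ! i" v "drop (Suc i) xs"] by simp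
qed simp

lemma boundary_simplex:
  assumes K: "finite (\<Union>K)" and c: "c \<in> oriented_chains K m" and i: "i < length xs"
    and supp: "\<And>ys. c ys \<noteq> 0 \<Longrightarrow> set ys = set xs"
    and xs: "c xs = 1"
  shows "boundary K c (take i xs @ drop (Suc i) xs) = (-1) ^ i"
proof -
  let ?ys = "take i xs @ drop (Suc i) xs" and ?v = "xs ! i"
  have face: "set xs \<in> K" "distinct xs" using c xs by (auto simp: oriented_chains_def)
  have split: "take i xs @ ?v # drop (Suc i) xs = xs" using i by (rule id_take_nth_drop[symmetric])
  have set_xs: "set xs = insert ?v (set ?ys)"
    using arg_cong[OF split, of set] by auto
  have v: "?v \<in> \<Union>K" using face(1) nth_mem[OF i] by blast
  have notin: "?v \<notin> set ?ys"
    using face(2) arg_cong[OF split, of distinct] by auto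
  have "c (w # ?ys) = 0" if "w \<noteq> ?v" for w
  proof (rule ccontr)
    assume "c (w # ?ys) \<noteq> 0"
    from supp[OF this] have "?v \<in> set (w # ?ys)" using set_xs by blast
    with that notin show False by simp
  qed
  then have "boundary K c ?ys = (\<Sum>w\<in>\<Union>K. if w = ?v then c (?v # ?ys) else 0)"
    unfolding boundary_def by (intro sum.cong) auto
  also have "\<dots> = c (?v # ?ys)" using K v by simp
  also have "\<dots> = (-1) ^ i"
  proof -
    have "c (take i ?ys @ ?v # drop i ?ys) = (-1) ^ i * c (?v # ?ys)"
      by (rule chains_insert_sign[OF c]) (use i in simp)
    moreover have "take i ?ys @ ?v # drop i ?ys = xs" using split i by simp
    ultimately have "1 = (-1) ^ i * c (?v # ?ys)" using xs by simp
    then have "(-1) ^ i = ((-1) ^ i * (-1) ^ i) * c (?v # ?ys)" by (metis mult.assoc mult.right_neutral)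
    then show ?thesis by (simp flip: power_mult_distrib)
  qed
  finally show ?thesis .
qed

lemma boundary_in_chains:
  assumes closed: "\<And>\<sigma> \<tau>. \<sigma> \<in> K \<Longrightarrow> \<tau> \<subseteq> \<sigma> \<Longrightarrow> \<tau> \<in> K" and c: "c \<in> oriented_chains K (Suc m)"
  shows "boundary K c \<in> oriented_chains K m"
proof -
  have "length xs = m \<and> distinct xs \<and> set xs \<in> K" if "boundary K c xs \<noteq> 0" for xs
  proof -
    from that obtain v where "c (v # xs) \<noteq> 0"
      unfolding boundary_def by (meson sum.not_neutral_contains_not_neutral)
    with c have "length (v # xs) = Suc m \<and> distinct (v # xs) \<and> set (v # xs) \<in> K"
      unfolding oriented_chains_def by blast
    then show ?thesis using closed[of "set (v # xs)" "set xs"] by auto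
  qed
  moreover have "boundary K c (xs @ a # b # ys) = - boundary K c (xs @ b # a # ys)" for xs a b ys
  proof -
    have "c (v # xs @ a # b # ys) = - c (v # xs @ b # a # ys)" for v
      using chains_swap[OF c, of "v # xs" a b ys] by (simp only: append_Cons)
    then have "(\<Sum>v\<in>\<Union>K. c (v # xs @ a # b # ys)) = (\<Sum>v\<in>\<Union>K. - c (v # xs @ b # a # ys))"
      by (intro sum.cong refl)
    then show ?thesis by (simp only: boundary_def sum_negf)
  qed
  ultimately show ?thesis unfolding oriented_chains_def by blast
qed

lemma sum_antisym_eq_0:
  fixes f :: "'v \<Rightarrow> 'v \<Rightarrow> 'k::field"
  assumes "finite V" and anti: "\<And>v w. f v w = - f w v" and diag: "\<And>v. f v v = 0"
  shows "(\<Sum>v\<in>V. \<Sum>w\<in>V. f v w) = 0"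
  using assms(1)
proof induction
  case (insert x V)
  have "(\<Sum>v\<in>insert x V. \<Sum>w\<in>insert x V. f v w)
      = f x x + (\<Sum>w\<in>V. f x w) + ((\<Sum>v\<in>V. f v x) + (\<Sum>v\<in>V. \<Sum>w\<in>V. f v w))"
    using insert.hyps by (simp add: sum.distrib)
  also have "(\<Sum>v\<in>V. f v x) = - (\<Sum>w\<in>V. f x w)"
    unfolding sum_negf[symmetric] by (rule sum.cong[OF refl]) (rule anti)
  finally show ?case using insert.IH diag by simp
qed simp

lemma boundary_boundary:
  assumes "finite (\<Union>K)" and c: "c \<in> oriented_chains K m"
  shows "boundary K (boundary K c) = (\<lambda>xs. 0)"
proof
  fix xs
  have swap: "c (w # v # xs) = - c (v # w # xs)" for v w
    using chains_swap[OF c, of "[]" w v xs] by (simp only: append_Nil)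
  have rep: "c (v # v # xs) = 0" for v
  proof (rule ccontr)
    assume "c (v # v # xs) \<noteq> 0"
    with c have "distinct (v # v # xs)" unfolding oriented_chains_def by blast
    then show False by simp
  qed
  show "boundary K (boundary K c) xs = 0"
    unfolding boundary_def by (rule sum_antisym_eq_0[OF assms(1) swap rep])
qed

lemma chains_zero: "(\<lambda>xs. 0) \<in> oriented_chains K m"
  by (simp add: oriented_chains_def)

lemma chains_lincomb:
  assumes "c \<in> oriented_chains K m" "d \<in> oriented_chains K m"
  shows "(\<lambda>xs. a * c xs + d xs) \<in> oriented_chains K m"
proof -
  have "a * c xs + d xs \<noteq> 0 \<Longrightarrow> c xs \<noteq> 0 \<or> d xs \<noteq> 0" for xs by auto
  moreover have "a * c (xs @ x # y # ys) + d (xs @ x # y # ys)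
      = - (a * c (xs @ y # x # ys) + d (xs @ y # x # ys))" for xs x y ys
  proof -
    show ?thesis
      unfolding chains_swap[OF assms(1), of xs x y ys] chains_swap[OF assms(2), of xs x y ys] by simp
  qed
  ultimately show ?thesis using assms unfolding oriented_chains_def by blast
qed

lemma boundary_lincomb:
  "boundary K (\<lambda>xs. a * c xs + d xs) = (\<lambda>xs. a * boundary K c xs + boundary K d xs)"
  by (simp add: boundary_def sum.distrib sum_distrib_left)

lemma cycles_lincomb:
  "c \<in> cycles K p \<Longrightarrow> d \<in> cycles K p \<Longrightarrow> (\<lambda>xs. a * c xs + d xs) \<in> cycles K p"
  by (simp add: cycles_def chains_lincomb boundary_lincomb)

lemma cycles_zero: "(\<lambda>xs. 0) \<in> cycles K p"
  by (simp add: cycles_def chains_zero boundary_def)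

lemma boundaries_lincomb:
  assumes "c \<in> boundaries K p" "d \<in> boundaries K p"
  shows "(\<lambda>xs. a * c xs + d xs) \<in> boundaries K p"
proof -
  from assms obtain c' d' where "c' \<in> oriented_chains K (p + 2)" "d' \<in> oriented_chains K (p + 2)"
    and "c = boundary K c'" "d = boundary K d'"
    unfolding boundaries_def by blast
  then show ?thesis
    unfolding boundaries_def
    by (intro image_eqI[OF _ chains_lincomb[of c' K "p + 2" d' a]]) (simp_all only: boundary_lincomb)
qed

lemma boundaries_zero: "(\<lambda>xs. 0) \<in> boundaries K p"
  unfolding boundaries_def by (rule image_eqI[OF _ chains_zero]) (simp add: boundary_def)

lemma boundaries_subset_cycles:
  assumes "\<And>\<sigma> \<tau>. \<sigma> \<in> K \<Longrightarrow> \<tau> \<subseteq> \<sigma> \<Longrightarrow> \<tau> \<in> K" and "finite (\<Union>K)"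
  shows "boundaries K p \<subseteq> cycles K p"
proof
  fix b assume "b \<in> boundaries K p"
  then obtain c where c: "c \<in> oriented_chains K (Suc (p + 1))" and b: "b = boundary K c"
    by (auto simp: boundaries_def)
  have "boundary K c \<in> oriented_chains K (p + 1)"
    using assms(1) c by (rule boundary_in_chains)
  then show "b \<in> cycles K p"
    unfolding cycles_def b using boundary_boundary[OF assms(2) c] by blast
qed

lemma homology_class_eq_iff:
  "homology_class K p z = homology_class K p w \<longleftrightarrow> (\<lambda>xs. z xs - w xs) \<in> boundaries K p"
proof
  assume "homology_class K p z = homology_class K p w"
  moreover have "z \<in> homology_class K p z"
    unfolding homology_class_def using boundaries_zero by force
  ultimately obtain b where "z = (\<lambda>xs. w xs + b xs)" "b \<in> boundaries K p"
    unfolding homology_class_def by blast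
  then show "(\<lambda>xs. z xs - w xs) \<in> boundaries K p" by simp
next
  have *: "homology_class K p z \<subseteq> homology_class K p w"
    if "(\<lambda>xs. z xs - w xs) \<in> boundaries K p" for z w :: "'a list \<Rightarrow> 'b"
  proof
    fix y assume "y \<in> homology_class K p z"
    then obtain b where b: "b \<in> boundaries K p" "y = (\<lambda>xs. z xs + b xs)"
      unfolding homology_class_def by blast
    from boundaries_lincomb[OF that b(1), of 1]
    have "(\<lambda>xs. (z xs - w xs) + b xs) \<in> boundaries K p" by simp
    then show "y \<in> homology_class K p w"
      unfolding homology_class_def b(2) by (intro CollectI exI conjI) (auto simp: fun_eq_iff)
  qed
  assume zw: "(\<lambda>xs. z xs - w xs) \<in> boundaries K p"
  from boundaries_lincomb[OF this boundaries_zero, of "-1"]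
  have "(\<lambda>xs. w xs - z xs) \<in> boundaries K p" by simp
  with zw show "homology_class K p z = homology_class K p w" using * by blast
qed

lemma reduced_homology_simps:
  shows "homology_class K p z \<oplus>\<^bsub>reduced_homology K p\<^esub> homology_class K p w
      = homology_class K p (\<lambda>xs. z xs + w xs)"
    and "a \<odot>\<^bsub>reduced_homology K p\<^esub> homology_class K p z = homology_class K p (\<lambda>xs. a * z xs)"
    and "\<zero>\<^bsub>reduced_homology K p\<^esub> = homology_class K p (\<lambda>xs. 0)"
    and "carrier (reduced_homology K p) = homology_class K p ` cycles K p"
proof -
  show "homology_class K p z \<oplus>\<^bsub>reduced_homology K p\<^esub> homology_class K p w
      = homology_class K p (\<lambda>xs. z xs + w xs)" (is "?l = ?r")
  proof
    show "?l \<subseteq> ?r"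
    proof
      fix y assume "y \<in> ?l"
      then obtain b d where bd: "b \<in> boundaries K p" "d \<in> boundaries K p"
        and y: "y = (\<lambda>xs. (z xs + b xs) + (w xs + d xs))"
        by (auto simp: reduced_homology_def homology_class_def)
      have "(\<lambda>xs. b xs + d xs) \<in> boundaries K p" using boundaries_lincomb[OF bd, of 1] by simp
      then show "y \<in> ?r" unfolding homology_class_def y
        by (intro CollectI exI[of _ "\<lambda>xs. b xs + d xs"] conjI) (auto simp: fun_eq_iff)
    qed
    show "?r \<subseteq> ?l"
    proof
      fix y assume "y \<in> ?r"
      then obtain b where b: "b \<in> boundaries K p" and y: "y = (\<lambda>xs. z xs + w xs + b xs)"
        by (auto simp: homology_class_def)
      have "z \<in> homology_class K p z" "(\<lambda>xs. w xs + b xs) \<in> homology_class K p w"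
        unfolding homology_class_def using boundaries_zero b by force+
      moreover have "y = (\<lambda>xs. z xs + (\<lambda>xs. w xs + b xs) xs)" by (simp add: y add.assoc)
      ultimately show "y \<in> ?l" unfolding reduced_homology_def by auto
    qed
  qed
  show "a \<odot>\<^bsub>reduced_homology K p\<^esub> homology_class K p z = homology_class K p (\<lambda>xs. a * z xs)"
    (is "?l = ?r")
  proof
    show "?l \<subseteq> ?r"
    proof
      fix y assume "y \<in> ?l"
      then obtain b d where bd: "b \<in> boundaries K p" "d \<in> boundaries K p"
        and y: "y = (\<lambda>xs. a * (z xs + b xs) + d xs)"
        by (auto simp: reduced_homology_def homology_class_def)
      then show "y \<in> ?r" unfolding homology_class_def y using boundaries_lincomb[OF bd, of a]
        by (intro CollectI exI[of _ "\<lambda>xs. a * b xs + d xs"] conjI) (auto simp: fun_eq_iff algebra_simps)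
    qed
    show "?r \<subseteq> ?l"
    proof
      fix y assume "y \<in> ?r"
      then obtain b where b: "b \<in> boundaries K p" and y: "y = (\<lambda>xs. a * z xs + b xs)"
        by (auto simp: homology_class_def)
      have "z \<in> homology_class K p z"
        unfolding homology_class_def using boundaries_zero by force
      with b show "y \<in> ?l" unfolding reduced_homology_def y by auto
    qed
  qed
  show "\<zero>\<^bsub>reduced_homology K p\<^esub> = homology_class K p (\<lambda>xs. 0)"
    by (simp add: reduced_homology_def homology_class_def)
  show "carrier (reduced_homology K p) = homology_class K p ` cycles K p"
    by (simp add: reduced_homology_def)
qed

lemma field_coeff_field: "field (coeff_field :: 'k::field ring)"
proof -
  have "\<exists>y. x + y = 0" for x :: 'k by (rule exI[of _ "- x"]) simp
  moreover have "\<exists>y. y * x = 1 \<and> x * y = 1" if "x \<noteq> 0" for x :: 'k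
    using that by (intro exI[of _ "inverse x"]) simp
  ultimately show ?thesis
    by unfold_locales (auto simp: Units_def algebra_simps)
qed

lemma vectorspace_reduced_homology:
  fixes K :: "'v set set"
  shows "vectorspace (coeff_field :: 'k::field ring) (reduced_homology K p)"
proof -
  have add: "(\<lambda>xs. z xs + w xs) \<in> cycles K p"
    if "z \<in> cycles K p" "w \<in> cycles K p" for z w :: "'v list \<Rightarrow> 'k"
    using cycles_lincomb[OF that, of 1] by simp
  have scale: "(\<lambda>xs. a * z xs) \<in> cycles K p"
    if "z \<in> cycles K p" for z :: "'v list \<Rightarrow> 'k" and a
    using cycles_lincomb[OF that cycles_zero, of a] by simp
  have neg: "(\<lambda>xs. - z xs) \<in> cycles K p" if "z \<in> cycles K p" for z :: "'v list \<Rightarrow> 'k"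
    using scale[OF that, of "-1"] by simp
  show ?thesis
    apply (rule vs_criteria[OF field_coeff_field])
    apply (auto simp: reduced_homology_simps algebra_simps cycles_zero add scale)
    subgoal for z
      by (rule bexI[of _ "\<lambda>xs. - z xs"]) (simp_all add: neg)
    done
qed

end

theory Submission
  imports Defs "HOL-Library.Function_Algebras"
begin

text \<open>
  Take points \<open>a s t\<close>, \<open>b s u\<close>, \<open>c u t\<close> with \<open>s, t, u < m\<close>, clustered around the vertices of a
  (nearly) unit equilateral triangle, such that two points of different clusters are adjacent iff
  they agree in the index that their families share, and points of the same cluster are always
  adjacent. Each triangle \<open>{a s t, b s u, c u t}\<close> is then a maximal face, so its coefficient is a
  linear functional on \<open>H\<^sub>2\<close>. For \<open>s, t, u \<ge> 1\<close> this triangle lies on a cuboctahedral 2-cycle whose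
  other triangles of this kind all have an index \<open>0\<close>. Hence these \<open>(m - 1)\<^sup>3\<close> cycles are
  independent, while there are only \<open>3 m\<^sup>2\<close> points.
\<close>

section \<open>Bounding Betti numbers from below and above\<close>

text \<open>Applying \<open>\<phi> i\<close> to a vanishing linear combination of the
  \<open>v j\<close> isolates the coefficient of \<open>v i\<close>, so the \<open>v j\<close> are
  independent; they are distinct for the same reason.\<close>

lemma card_le_dim_if_dual_family:
  fixes V :: "('k::field, 'c, 'z) module_scheme" and \<phi> :: "'i \<Rightarrow> 'c \<Rightarrow> 'k"
  assumes vs: "vectorspace coeff_field V" and fd: "vectorspace.fin_dim coeff_field V"
    and I: "finite I"
    and v: "\<And>i. i \<in> I \<Longrightarrow> v i \<in> carrier V"
    and add: "\<And>i x y. \<lbrakk>i \<in> I; x \<in> carrier V; y \<in> carrier V\<rbrakk> \<Longrightarrow> \<phi> i (x \<oplus>\<^bsub>V\<^esub> y) = \<phi> i x + \<phi> i y"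
    and smult: "\<And>i a x. \<lbrakk>i \<in> I; x \<in> carrier V\<rbrakk> \<Longrightarrow> \<phi> i (a \<odot>\<^bsub>V\<^esub> x) = a * \<phi> i x"
    and dual: "\<And>i j. \<lbrakk>i \<in> I; j \<in> I\<rbrakk> \<Longrightarrow> \<phi> i (v j) = (if i = j then 1 else 0)"
  shows "card I \<le> vectorspace.dim coeff_field V"
proof -
  interpret vectorspace coeff_field V by (rule vs)
  have zero: "\<phi> i \<zero>\<^bsub>V\<^esub> = 0" if "i \<in> I" for i
    using smult[OF that M.zero_closed, of 0] by simp
  have lincomb: "\<phi> i (lincomb a A) = (\<Sum>x\<in>A. a x * \<phi> i x)"
    if "finite A" "A \<subseteq> carrier V" "i \<in> I" for i a A
    using that(1,2)
  proof induction
    case empty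
    then show ?case using zero[OF that(3)] by (simp add: lincomb_def)
  next
    case (insert x A)
    have "lincomb a (insert x A) = a x \<odot>\<^bsub>V\<^esub> x \<oplus>\<^bsub>V\<^esub> lincomb a A"
      using lincomb_insert[of A a x] insert by simp
    then show ?case
      using insert that(3) by (simp add: add smult smult_closed lincomb_closed)
  qed
  have inj: "inj_on v I"
  proof (rule inj_onI)
    fix i j assume "i \<in> I" "j \<in> I" "v i = v j"
    then show "i = j" using dual[of i i] dual[of i j] by (auto split: if_splits)
  qed
  have sub: "v ` I \<subseteq> carrier V" using v by blast
  have "lin_indpt (v ` I)"
  proof (rule finite_lin_indpt2)
    fix a assume 0: "lincomb a (v ` I) = \<zero>\<^bsub>V\<^esub>"
    have "a (v i) = 0" if i: "i \<in> I" for i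
    proof -
      have "0 = (\<Sum>x\<in>v ` I. a x * \<phi> i x)"
        using lincomb[OF finite_imageI[OF I] sub i, of a] 0 zero[OF i] by simp
      also have "\<dots> = (\<Sum>j\<in>I. if i = j then a (v j) else 0)"
        unfolding sum.reindex[OF inj] o_def by (intro sum.cong refl) (simp add: dual i)
      finally show ?thesis using I i by simp
    qed
    then show "\<forall>x\<in>v ` I. a x = \<zero>\<^bsub>coeff_field\<^esub>" by simp
  qed (use I sub in simp_all)
  from li_le_dim(2)[OF fd sub this] show ?thesis by (simp add: card_image inj)
qed

text \<open>Cycles lie in the span of the indicator functions of the lists of \<open>p + 1\<close>
  vertices, so a maximal independent set of cycles has at most as many elements as there are such
  lists; its classes generate homology. Finite dimension is needed for the lower bound on Betti
  numbers, the cardinality for the upper one.\<close>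

lemma reduced_homology_finite_generators:
  fixes K :: "'v set set"
  assumes fin: "finite (\<Union>K)"
  obtains A where "finite A" "card A \<le> card (\<Union>K) ^ (p + 1)"
    "A \<subseteq> carrier (reduced_homology K p :: ('k::field, ('v list \<Rightarrow> 'k) set) module)"
    "LinearCombinations.module.span coeff_field (reduced_homology K p) A = carrier (reduced_homology K p)"
proof -
  let ?H = "reduced_homology K p :: ('k, ('v list \<Rightarrow> 'k) set) module"
  interpret H: vectorspace "coeff_field :: 'k ring" ?H by (rule vectorspace_reduced_homology)
  interpret F: vector_space "\<lambda>(a::'k) f (xs::'v list). a * f xs"
    by unfold_locales (auto simp: fun_eq_iff algebra_simps)
  define L where "L = {xs. set xs \<subseteq> \<Union>K \<and> length xs = p + 1}"
  define E where "E = (\<lambda>(l::'v list) xs. if xs = l then 1 else 0 :: 'k)"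
  have L: "finite L" "card L = card (\<Union>K) ^ (p + 1)"
    unfolding L_def using fin by (simp_all only: finite_lists_length_eq card_lists_length_eq)
  obtain B :: "('v list \<Rightarrow> 'k) set" where B: "B \<subseteq> cycles K p" "F.independent B" "cycles K p \<subseteq> F.span B"
    by (rule F.maximal_independent_subset)
  have "cycles K p \<subseteq> F.span (E ` L)"
  proof
    fix c :: "'v list \<Rightarrow> 'k" assume "c \<in> cycles K p"
    then have "c xs \<noteq> 0 \<Longrightarrow> xs \<in> L" for xs
      unfolding cycles_def oriented_chains_def L_def by blast
    then have expand: "c xs = (\<Sum>l\<in>L. c l * E l xs)" for xs
      using L(1) by (cases "xs \<in> L") (auto simp: E_def if_distrib cong: if_cong)
    have pointwise: "(\<Sum>l\<in>L. (\<lambda>xs. c l * E l xs)) xs = (\<Sum>l\<in>L. c l * E l xs)" for xs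
      using L(1) by induction auto
    have "c = (\<Sum>l\<in>L. (\<lambda>xs. c l * E l xs))"
      by (rule ext) (rule trans[OF expand pointwise[symmetric]])
    also have "\<dots> \<in> F.span (E ` L)"
      by (intro F.span_sum F.span_scale F.span_base imageI)
    finally show "c \<in> F.span (E ` L)" .
  qed
  with F.independent_span_bound[OF finite_imageI[OF L(1)] B(2), of E] B(1)
  have cardB: "finite B" "card B \<le> card (E ` L)" by auto
  define A where "A = homology_class K p ` B"
  have Asub: "A \<subseteq> carrier ?H" unfolding A_def reduced_homology_simps using B(1) by blast
  have sub: "LinearCombinations.submodule coeff_field (H.span A) ?H" by (rule H.span_is_submodule[OF Asub])
  have "carrier ?H \<subseteq> H.span A"
  proof
    fix X assume "X \<in> carrier ?H"
    then obtain z where z: "z \<in> cycles K p" "X = homology_class K p z"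
      unfolding reduced_homology_simps by blast
    have "z \<in> F.span B" using z B by blast
    then have "homology_class K p z \<in> H.span A"
    proof (rule F.span_induct)
      \<comment> \<open>\<open>homology_class\<close> is defined on all functions and respects sums
        and multiples even off the cycles, so the induction need not carry membership in
        \<open>cycles K p\<close>.\<close>
      show "F.subspace {z. homology_class K p z \<in> H.span A}"
      proof (rule F.subspaceI; clarsimp)
        show "homology_class K p 0 \<in> H.span A"
          using LinearCombinations.submodule.zero_closed[OF sub]
          by (simp add: reduced_homology_simps zero_fun_def)
      next
        fix x y assume "homology_class K p x \<in> H.span A" "homology_class K p y \<in> H.span A"
        then show "homology_class K p (x + y) \<in> H.span A"
          using LinearCombinations.submodule.m_closed[OF sub, of "homology_class K p x" "homology_class K p y"]
          by (simp add: reduced_homology_simps plus_fun_def)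
      next
        fix a x assume "homology_class K p x \<in> H.span A"
        then show "homology_class K p (\<lambda>xs. a * x xs) \<in> H.span A"
          using LinearCombinations.submodule.smult_closed[OF sub, of a "homology_class K p x"]
          by (simp add: reduced_homology_simps)
      qed
    next
      fix b assume "b \<in> B"
      then show "homology_class K p b \<in> H.span A" using H.in_own_span[OF Asub] unfolding A_def by blast
    qed
    then show "X \<in> H.span A" using z by simp
  qed
  moreover have "H.span A \<subseteq> carrier ?H" using sub by (rule LinearCombinations.submodule.subset)
  moreover have "card A \<le> card (\<Union>K) ^ (p + 1)"
    using card_image_le[OF cardB(1), of "homology_class K p"] cardB(2) card_image_le[OF L(1), of E] L(2)
    unfolding A_def by linarith
  ultimately show thesis using that[of A] Asub cardB(1) unfolding A_def by blast
qed

lemma reduced_betti_le: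
  assumes "finite (\<Union>K)"
  shows "reduced_betti TYPE('k::field) p K \<le> card (\<Union>K) ^ (p + 1)"
proof -
  interpret H: vectorspace "coeff_field :: 'k ring" "reduced_homology K p"
    by (rule vectorspace_reduced_homology)
  obtain A where A: "finite A" "card A \<le> card (\<Union>K) ^ (p + 1)"
    "A \<subseteq> carrier (reduced_homology K p :: ('k, ('a list \<Rightarrow> 'k) set) module)"
    "H.span A = carrier (reduced_homology K p)"
    by (rule reduced_homology_finite_generators[OF assms])
  show ?thesis
    using H.gen_ge_dim[OF A(1,3,4)] A(2) unfolding reduced_betti_def by linarith
qed

text \<open>Evaluation at \<open>\<tau> i\<close> kills boundaries and so descends to a linear
  functional on homology; these functionals are dual to the classes of the
  \<open>z j\<close>.\<close>

lemma card_le_reduced_betti: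
  fixes z :: "'i \<Rightarrow> 'v list \<Rightarrow> 'k::field"
  assumes fin: "finite (\<Union>K)" and I: "finite I"
    and z: "\<And>i. i \<in> I \<Longrightarrow> z i \<in> cycles K p"
    and bd: "\<And>i b. \<lbrakk>i \<in> I; b \<in> boundaries K p\<rbrakk> \<Longrightarrow> b (\<tau> i) = (0 :: 'k)"
    and dual: "\<And>i j. \<lbrakk>i \<in> I; j \<in> I\<rbrakk> \<Longrightarrow> z j (\<tau> i) = (if i = j then 1 else 0)"
  shows "card I \<le> reduced_betti TYPE('k) p K"
proof -
  let ?H = "reduced_homology K p :: ('k, ('v list \<Rightarrow> 'k) set) module"
  interpret H: vectorspace "coeff_field :: 'k ring" ?H by (rule vectorspace_reduced_homology)
  \<comment> \<open>The choice of the representative is immaterial: two of them differ by a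
    boundary, which vanishes at \<open>\<tau> i\<close>.\<close>
  define \<phi> where "\<phi> = (\<lambda>i (X :: ('v list \<Rightarrow> 'k) set). (SOME x. x \<in> X) (\<tau> i))"
  have \<phi>: "\<phi> i (homology_class K p c) = c (\<tau> i)" if "i \<in> I" for i c
  proof -
    have "c \<in> homology_class K p c" unfolding homology_class_def using boundaries_zero by force
    then have "(SOME x. x \<in> homology_class K p c) \<in> homology_class K p c" by (rule someI[where P = "\<lambda>x. x \<in> homology_class K p c"])
    then show ?thesis unfolding \<phi>_def using bd[OF that] by (auto simp: homology_class_def)
  qed
  have fd: "H.fin_dim"
    by (rule reduced_homology_finite_generators[OF fin, of p, where 'k = 'k]) (auto simp: H.fin_dim_def)
  show ?thesis unfolding reduced_betti_def
    by (rule card_le_dim_if_dual_family[OF H.vectorspace_axioms fd I, of "\<lambda>i. homology_class K p (z i)" \<phi>])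
      (auto simp: \<phi> dual reduced_homology_simps z)
qed

section \<open>Oriented edges and triangles as explicit chains\<close>

definition edge_chain :: "'v \<Rightarrow> 'v \<Rightarrow> 'v list \<Rightarrow> 'k::field" where
  "edge_chain x y xs = (case xs of
      [u, v] \<Rightarrow> of_bool (u = x \<and> v = y) - of_bool (u = y \<and> v = x)
    | _ \<Rightarrow> 0)"

text \<open>This is the 3 by 3 determinant of the indicators of \<open>x\<close>, \<open>y\<close>,
  \<open>z\<close> at the entries \<open>u\<close>, \<open>v\<close>, \<open>w\<close>, expanded
  along \<open>u\<close>. The expansion displays the boundary, which sums over the first
  entry.\<close>

definition triangle_chain :: "'v \<Rightarrow> 'v \<Rightarrow> 'v \<Rightarrow> 'v list \<Rightarrow> 'k::field" where
  "triangle_chain x y z xs = (case xs of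
      [u, v, w] \<Rightarrow> of_bool (u = x) * edge_chain y z [v, w] - of_bool (u = y) * edge_chain x z [v, w]
        + of_bool (u = z) * edge_chain x y [v, w]
    | _ \<Rightarrow> 0)"

lemma edge_chain_neq_0:
  assumes "edge_chain x y [u, v] \<noteq> (0 :: 'k::field)"
  shows "u = x \<and> v = y \<or> u = y \<and> v = x"
proof (rule ccontr)
  assume "\<not> ?thesis"
  then have "edge_chain x y [u, v] = (0 :: 'k)" by (auto simp: edge_chain_def)
  with assms show False by contradiction
qed

lemma triangle_chain_neq_0:
  assumes "triangle_chain x y z [u, v, w] \<noteq> (0 :: 'k::field)"
  shows "u = x \<and> (v = y \<and> w = z \<or> v = z \<and> w = y) \<or> u = y \<and> (v = x \<and> w = z \<or> v = z \<and> w = x)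
    \<or> u = z \<and> (v = x \<and> w = y \<or> v = y \<and> w = x)"
proof (rule ccontr)
  assume *: "\<not> ?thesis"
  have e1: "of_bool (u = x) * edge_chain y z [v, w] = (0 :: 'k)"
    using * edge_chain_neq_0[of y z v w, where 'k = 'k] by (cases "u = x") auto
  have e2: "of_bool (u = y) * edge_chain x z [v, w] = (0 :: 'k)"
    using * edge_chain_neq_0[of x z v w, where 'k = 'k] by (cases "u = y") auto
  have e3: "of_bool (u = z) * edge_chain x y [v, w] = (0 :: 'k)"
    using * edge_chain_neq_0[of x y v w, where 'k = 'k] by (cases "u = z") auto
  have "triangle_chain x y z [u, v, w] = (0 :: 'k)"
    by (simp only: triangle_chain_def list.case e1 e2 e3 diff_zero add_0)
  with assms show False by contradiction
qed

lemma edge_chain_length: "length xs \<noteq> 2 \<Longrightarrow> edge_chain x y xs = (0 :: 'k::field)"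
  by (cases xs; cases "tl xs"; cases "tl (tl xs)"; simp add: edge_chain_def)

text \<open>Once conjunctions are split into products of indicators, both claims are the
  antisymmetry of a determinant in nine unknowns.\<close>

lemma triangle_chain_swap:
  fixes x y z :: 'v
  shows "triangle_chain x y z [v, u, w] = (- triangle_chain x y z [u, v, w] :: 'k::field)"
    and "triangle_chain x y z [u, w, v] = (- triangle_chain x y z [u, v, w] :: 'k)"
proof -
  have "v1 * (u2 * w3 - u3 * w2) - v2 * (u1 * w3 - u3 * w1) + v3 * (u1 * w2 - u2 * w1)
      = - (u1 * (v2 * w3 - v3 * w2) - u2 * (v1 * w3 - v3 * w1) + u3 * (v1 * w2 - v2 * w1))"
    for u1 u2 u3 v1 v2 v3 w1 w2 w3 :: 'k
    by (simp add: algebra_simps)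
  then show "triangle_chain x y z [v, u, w] = (- triangle_chain x y z [u, v, w] :: 'k)"
    unfolding triangle_chain_def edge_chain_def list.case of_bool_conj .
  have "u1 * (w2 * v3 - w3 * v2) - u2 * (w1 * v3 - w3 * v1) + u3 * (w1 * v2 - w2 * v1)
      = - (u1 * (v2 * w3 - v3 * w2) - u2 * (v1 * w3 - v3 * w1) + u3 * (v1 * w2 - v2 * w1))"
    for u1 u2 u3 v1 v2 v3 w1 w2 w3 :: 'k
    by (simp add: algebra_simps)
  then show "triangle_chain x y z [u, w, v] = (- triangle_chain x y z [u, v, w] :: 'k)"
    unfolding triangle_chain_def edge_chain_def list.case of_bool_conj .
qed

lemma triangle_chain_length: "length xs \<noteq> 3 \<Longrightarrow> triangle_chain x y z xs = (0 :: 'k::field)"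
  by (cases xs; cases "tl xs"; cases "tl (tl xs)"; cases "tl (tl (tl xs))"; simp add: triangle_chain_def)

lemma triangle_chain_in_chains:
  assumes "{x, y, z} \<in> K" "x \<noteq> y" "y \<noteq> z" "x \<noteq> z"
  shows "(triangle_chain x y z :: 'v list \<Rightarrow> 'k::field) \<in> oriented_chains K 3"
proof -
  let ?t = "triangle_chain x y z :: 'v list \<Rightarrow> 'k"
  have "length xs = 3 \<and> distinct xs \<and> set xs \<in> K" if "?t xs \<noteq> 0" for xs
  proof -
    have "length xs = 3" using triangle_chain_length[of xs x y z, where 'k = 'k] that by blast
    then obtain u v w where xs: "xs = [u, v, w]" by (auto simp: numeral_3_eq_3 length_Suc_conv)
    from triangle_chain_neq_0[OF that[unfolded xs]]
    have "set xs = {x, y, z} \<and> distinct xs"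
      unfolding xs by (elim disjE conjE) (use assms(2-4) in \<open>simp_all add: insert_commute\<close>)
    then show ?thesis using assms(1) xs by simp
  qed
  moreover have "?t (xs @ a # b # ys) = - ?t (xs @ b # a # ys)" for xs a b ys
  proof (cases "length (xs @ a # b # ys) = 3")
    case True
    then consider c where "xs = []" "ys = [c]" | c where "xs = [c]" "ys = []"
      by (cases xs; cases ys) auto
    then show ?thesis
      using triangle_chain_swap(1)[of x y z a b] triangle_chain_swap(2)[of x y z _ a b]
      by cases simp_all
  next
    case False
    then show ?thesis by (simp add: triangle_chain_length)
  qed
  ultimately show ?thesis unfolding oriented_chains_def by blast
qed

lemma boundary_triangle_chain:
  assumes "finite (\<Union>K)" "{x, y, z} \<in> K"
  shows "boundary K (triangle_chain x y z :: 'v list \<Rightarrow> 'k::field)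
    = (\<lambda>xs. edge_chain y z xs - edge_chain x z xs + edge_chain x y xs)"
proof
  fix xs
  have mem: "x \<in> \<Union>K" "y \<in> \<Union>K" "z \<in> \<Union>K" using assms(2) by blast+
  show "boundary K (triangle_chain x y z :: 'v list \<Rightarrow> 'k) xs
    = edge_chain y z xs - edge_chain x z xs + edge_chain x y xs"
  proof (cases "length xs = 2")
    case True
    then obtain v w where xs: "xs = [v, w]" by (auto simp: numeral_2_eq_2 length_Suc_conv)
    have pick: "(\<Sum>u\<in>\<Union>K. of_bool (u = x) * e) = e" if "x \<in> \<Union>K" for x and e :: 'k
      using assms(1) that by (simp add: of_bool_def if_distrib[of "\<lambda>r. r * e"] cong: if_cong)
    show ?thesis
      by (simp add: xs boundary_def triangle_chain_def sum.distrib sum_subtractf pick[OF mem(1)] pick[OF mem(2)] pick[OF mem(3)])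
  next
    case False
    then show ?thesis by (simp add: boundary_def edge_chain_length triangle_chain_length)
  qed
qed

lemma triangle_chain_eq_0:
  assumes "\<not> {u, v, w} \<subseteq> {x, y, z}"
  shows "triangle_chain x y z [u, v, w] = (0 :: 'k::field)"
proof (rule ccontr)
  assume "\<not> ?thesis"
  from triangle_chain_neq_0[OF this] assms show False by blast
qed

text \<open>Only the diagonal term of the determinant survives. This applies to lists whose entries
  come from the families \<open>a\<close>, \<open>b\<close>, \<open>c\<close> in this order.\<close>

lemma triangle_chain_sorted:
  assumes "u \<noteq> y" "u \<noteq> z" "v \<noteq> z"
  shows "triangle_chain x y z [u, v, w] = of_bool (u = x \<and> v = y \<and> w = z)"
  using assms by (simp add: triangle_chain_def edge_chain_def)

lemma chains_add: "c \<in> oriented_chains K m \<Longrightarrow> d \<in> oriented_chains K m \<Longrightarrow> c + d \<in> oriented_chains K m"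
  using chains_lincomb[of c K m d 1] by (simp add: plus_fun_def)

lemma chains_diff: "c \<in> oriented_chains K m \<Longrightarrow> d \<in> oriented_chains K m \<Longrightarrow> c - d \<in> oriented_chains K m"
  using chains_lincomb[of d K m c "-1"] by (simp add: fun_diff_def)

lemma boundary_add: "boundary K (c + d) = boundary K c + boundary K d"
  by (simp add: boundary_def sum.distrib fun_eq_iff)

lemma boundary_diff: "boundary K (c - d) = boundary K c - boundary K d"
  by (simp add: boundary_def sum_subtractf fun_eq_iff)

text \<open>The quadrilateral with vertices \<open>x\<close>, \<open>y\<close>, \<open>x'\<close>,
  \<open>y'\<close> in cyclic order, cut along the diagonal from \<open>x\<close> to
  \<open>x'\<close>, which cancels in the boundary. In every use \<open>x\<close> and
  \<open>x'\<close> belong to one family.\<close>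

definition square_chain :: "'v \<Rightarrow> 'v \<Rightarrow> 'v \<Rightarrow> 'v \<Rightarrow> 'v list \<Rightarrow> 'k::field" where
  "square_chain x x' y y' = triangle_chain x x' y - triangle_chain x x' y'"

section \<open>Homology of the combinatorial grid\<close>

text \<open>Separates the homology computation from the coordinates of the points. Faces are
  prescribed from below, and only \<open>abc_maximal\<close> forbids any.\<close>

locale triangle_grid =
  fixes K :: "'v set set" and m :: nat and a b c :: "nat \<Rightarrow> nat \<Rightarrow> 'v"
  assumes fin: "finite (\<Union>K)"
    and a_eq [simp]: "\<lbrakk>s < m; t < m; s' < m; t' < m\<rbrakk> \<Longrightarrow> a s t = a s' t' \<longleftrightarrow> s = s' \<and> t = t'"
    and b_eq [simp]: "\<lbrakk>s < m; u < m; s' < m; u' < m\<rbrakk> \<Longrightarrow> b s u = b s' u' \<longleftrightarrow> s = s' \<and> u = u'"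
    and c_eq [simp]: "\<lbrakk>u < m; t < m; u' < m; t' < m\<rbrakk> \<Longrightarrow> c u t = c u' t' \<longleftrightarrow> u = u' \<and> t = t'"
    and ab [simp]: "\<lbrakk>s < m; t < m; s' < m; u < m\<rbrakk> \<Longrightarrow> a s t \<noteq> b s' u"
    and ac [simp]: "\<lbrakk>s < m; t < m; u < m; t' < m\<rbrakk> \<Longrightarrow> a s t \<noteq> c u t'"
    and bc [simp]: "\<lbrakk>s < m; u < m; u' < m; t < m\<rbrakk> \<Longrightarrow> b s u \<noteq> c u' t"
    and abc: "\<lbrakk>s < m; t < m; u < m\<rbrakk> \<Longrightarrow> {a s t, b s u, c u t} \<in> K"
    and aab: "\<lbrakk>s < m; t < m; t' < m; u < m\<rbrakk> \<Longrightarrow> {a s t, a s t', b s u} \<in> K"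
    and aac: "\<lbrakk>s < m; s' < m; t < m; u < m\<rbrakk> \<Longrightarrow> {a s t, a s' t, c u t} \<in> K"
    and bbc: "\<lbrakk>s < m; s' < m; t < m; u < m\<rbrakk> \<Longrightarrow> {b s u, b s' u, c u t} \<in> K"
    and abc_maximal: "\<lbrakk>s < m; t < m; u < m; insert v {a s t, b s u, c u t} \<in> K\<rbrakk>
      \<Longrightarrow> v \<in> {a s t, b s u, c u t}"
begin

text \<open>
  The eight triangles \<open>{a s t, b s u, c u t}\<close> with indices in \<open>{0, s} \<times> {0, t} \<times> {0, u}\<close> have no edge in
  common. Their edges between two of the three families form six quadrilaterals, each of which is
  filled by two more triangles; the result is a cuboctahedron.
\<close>

definition cuboctahedron :: "nat \<times> nat \<times> nat \<Rightarrow> 'v list \<Rightarrow> 'k::field" where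
  "cuboctahedron = (\<lambda>(s, t, u).
      triangle_chain (a s t) (b s u) (c u t) - triangle_chain (a 0 t) (b 0 u) (c u t)
    - triangle_chain (a s 0) (b s u) (c u 0) - triangle_chain (a s t) (b s 0) (c 0 t)
    + triangle_chain (a 0 0) (b 0 u) (c u 0) + triangle_chain (a 0 t) (b 0 0) (c 0 t)
    + triangle_chain (a s 0) (b s 0) (c 0 0) - triangle_chain (a 0 0) (b 0 0) (c 0 0)
    + square_chain (a s 0) (a s t) (b s 0) (b s u) - square_chain (a 0 0) (a 0 t) (b 0 0) (b 0 u)
    + square_chain (a 0 0) (a s 0) (c 0 0) (c u 0) - square_chain (a 0 t) (a s t) (c 0 t) (c u t)
    + square_chain (b 0 u) (b s u) (c u 0) (c u t) - square_chain (b 0 0) (b s 0) (c 0 0) (c 0 t))"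

text \<open>A triangle \<open>{a i j, b i k, c k j}\<close> carries the sign -1 to the number of its
  indices that are 0. For two families and a fixed value of the index they share, the edges of these
  triangles thus form a 4-cycle of alternating signs, which cancels against the boundary of one
  square.\<close>

lemma cuboctahedron_cycle:
  assumes "s \<in> {1..<m}" "t \<in> {1..<m}" "u \<in> {1..<m}"
  shows "(cuboctahedron (s, t, u) :: 'v list \<Rightarrow> 'k::field) \<in> cycles K 2"
proof -
  have less: "s < m" "t < m" "u < m" "0 < m" and pos: "s \<noteq> 0" "t \<noteq> 0" "u \<noteq> 0"
    using assms by auto
  have "(cuboctahedron (s, t, u) :: 'v list \<Rightarrow> 'k) \<in> oriented_chains K 3"
    unfolding cuboctahedron_def square_chain_def prod.case
    by (intro chains_add chains_diff triangle_chain_in_chains abc aab aac bbc) (simp_all add: less pos pos[symmetric])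
  moreover have "boundary K (cuboctahedron (s, t, u) :: 'v list \<Rightarrow> 'k) = (\<lambda>xs. 0)"
    unfolding cuboctahedron_def square_chain_def prod.case
    by (simp add: boundary_add boundary_diff boundary_triangle_chain[OF fin] abc aab aac bbc less fun_eq_iff)
  ultimately show ?thesis by (simp add: cycles_def numeral_3_eq_3 numeral_2_eq_2)
qed

text \<open>The coefficient is a sum over cofaces with one more vertex, and a maximal face has
  none.\<close>

lemma boundary_at_maximal_triangle:
  assumes "s < m" "t < m" "u < m" "d \<in> boundaries K 2"
  shows "d [a s t, b s u, c u t] = (0 :: 'k::field)"
proof -
  obtain e :: "'v list \<Rightarrow> 'k" where e: "e \<in> oriented_chains K 4" "d = boundary K e"
    using assms(4) by (auto simp: boundaries_def)
  have "e (v # [a s t, b s u, c u t]) = 0" for v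
  proof (rule ccontr)
    assume "e (v # [a s t, b s u, c u t]) \<noteq> 0"
    with e(1) have "distinct (v # [a s t, b s u, c u t])" "set (v # [a s t, b s u, c u t]) \<in> K"
      unfolding oriented_chains_def by blast+
    then show False using abc_maximal[OF assms(1-3), of v] by simp
  qed
  then show ?thesis by (simp add: e(2) boundary_def)
qed

text \<open>The triangles filling the squares miss one of the three families, and the other seven
  mixed triangles have an index 0, so only the leading triangle can match positive
  \<open>s'\<close>, \<open>t'\<close>, \<open>u'\<close>.\<close>

lemma cuboctahedron_dual:
  assumes "s \<in> {1..<m}" "t \<in> {1..<m}" "u \<in> {1..<m}" "s' < m" "t' < m" "u' < m"
    and pos: "s' \<noteq> 0" "t' \<noteq> 0" "u' \<noteq> 0"
  shows "cuboctahedron (s, t, u) [a s' t', b s' u', c u' t']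
    = (of_bool (s = s' \<and> t = t' \<and> u = u') :: 'k::field)"
proof -
  have less: "s < m" "t < m" "u < m" "0 < m" using assms by auto
  let ?\<tau> = "[a s' t', b s' u', c u' t']"
  have abc: "triangle_chain (a i j) (b i k) (c k j) ?\<tau> = (of_bool (i = s' \<and> j = t' \<and> k = u') :: 'k)"
    if "i < m" "j < m" "k < m" for i j k
    using that assms(4-6) by (subst triangle_chain_sorted) auto
  have "triangle_chain (a i j) (a i' j') (b k l) ?\<tau> = (0 :: 'k)"
    if "i < m" "j < m" "i' < m" "j' < m" "k < m" "l < m" for i j i' j' k l
    using that assms(4-6) ac[symmetric] bc[symmetric] by (intro triangle_chain_eq_0) simp
  moreover have "triangle_chain (a i j) (a i' j') (c k l) ?\<tau> = (0 :: 'k)"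
    if "i < m" "j < m" "i' < m" "j' < m" "k < m" "l < m" for i j i' j' k l
    using that assms(4-6) ab[symmetric] bc by (intro triangle_chain_eq_0) simp
  moreover have "triangle_chain (b i j) (b i' j') (c k l) ?\<tau> = (0 :: 'k)"
    if "i < m" "j < m" "i' < m" "j' < m" "k < m" "l < m" for i j i' j' k l
    using that assms(4-6) ab ac by (intro triangle_chain_eq_0) simp
  ultimately show ?thesis
    by (simp add: cuboctahedron_def square_chain_def abc less pos[symmetric])
qed

end

section \<open>Coordinates and distances\<close>

text \<open>
  The first two coordinates are those of the triangle \<open>(0, 0), (1, 0), (1/2, \<surd>3/2)\<close> plus a
  correction quadratic in the parameters. It is chosen to cancel, up to fourth order, the
  contribution to the distances of the parameters that two families do not share: the squared
  distance of \<open>grid_a s t\<close> and \<open>grid_b s' u\<close> would otherwise be \<open>1 + (s - s')\<^sup>2 + t\<^sup>2 + u\<^sup>2\<close>.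
\<close>

definition grid_a :: "real \<Rightarrow> real \<Rightarrow> real \<times> real \<times> real \<times> real \<times> real" where
  "grid_a s t = (t\<^sup>2 / 2, sqrt 3 / 2 * ((2 * s\<^sup>2 - t\<^sup>2) / 3), s, t, 0)"

definition grid_b :: "real \<Rightarrow> real \<Rightarrow> real \<times> real \<times> real \<times> real \<times> real" where
  "grid_b s u = (1 - u\<^sup>2 / 2, sqrt 3 / 2 * ((2 * s\<^sup>2 - u\<^sup>2) / 3), s, 0, u)"

definition grid_c :: "real \<Rightarrow> real \<Rightarrow> real \<times> real \<times> real \<times> real \<times> real" where
  "grid_c u t = (1 / 2 + (t\<^sup>2 - u\<^sup>2) / 2, sqrt 3 / 2 * (1 - (u\<^sup>2 + t\<^sup>2) / 3), 0, t, u)"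

lemma dist_5_square:
  "(dist (x1, x2, x3, x4, x5) (y1, y2, y3, y4, y5))\<^sup>2
    = (x1 - y1)\<^sup>2 + (x2 - y2)\<^sup>2 + (x3 - y3)\<^sup>2 + (x4 - y4)\<^sup>2 + (x5 - y5 :: real)\<^sup>2"
  for x1 x2 x3 x4 x5 :: real
  by (simp add: dist_Pair_Pair dist_real_def)

lemma half_sqrt_3_diff: "(sqrt 3 / 2 * x - sqrt 3 / 2 * y)\<^sup>2 = 3 / 4 * (x - y)\<^sup>2"
proof -
  have "(sqrt 3 / 2 * x - sqrt 3 / 2 * y)\<^sup>2 = (sqrt 3 / 2)\<^sup>2 * (x - y)\<^sup>2"
    by (simp only: right_diff_distrib[symmetric] power_mult_distrib)
  then show ?thesis by (simp add: power_divide)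
qed

lemmas grid_dist = grid_a_def grid_b_def grid_c_def dist_5_square half_sqrt_3_diff

text \<open>Used with \<open>z\<close> equal to \<open>r\<^sup>2\<close>. The weight 3/4 is the
  square of \<open>sqrt 3 / 2\<close>, and the sum is in fact at most 7/3 of
  \<open>z\<^sup>2\<close>.\<close>

lemma weighted_sum_squares_le:
  fixes x y z :: real
  assumes "\<bar>x\<bar> \<le> z" "\<bar>y\<bar> \<le> 4 / 3 * z"
  shows "x\<^sup>2 + 3 / 4 * y\<^sup>2 \<le> 4 * z\<^sup>2"
proof -
  have "x\<^sup>2 \<le> z\<^sup>2" "y\<^sup>2 \<le> (4 / 3 * z)\<^sup>2"
    using assms by (auto intro: abs_le_square_iff[THEN iffD1])
  moreover have "(4 / 3 * z)\<^sup>2 = 16 / 9 * z\<^sup>2" by (simp add: power_mult_distrib power_divide)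
  ultimately show ?thesis using zero_le_power2[of z] by linarith
qed

text \<open>The first coordinates differ by \<open>1 - (t\<^sup>2 + u\<^sup>2) / 2\<close>, whose
  square contributes \<open>- (t\<^sup>2 + u\<^sup>2)\<close> and cancels the unshared parameters.
  The remaining error is a sum of squares, hence nonnegative and of fourth order.\<close>

lemma dist_grid_ab:
  assumes "\<bar>s\<bar> \<le> r" "\<bar>t\<bar> \<le> r" "\<bar>s'\<bar> \<le> r" "\<bar>u\<bar> \<le> r"
  shows "(dist (grid_a s t) (grid_b s' u))\<^sup>2 \<in> {1 + (s - s')\<^sup>2 .. 1 + (s - s')\<^sup>2 + 4 * r ^ 4}"
proof -
  have "s\<^sup>2 \<le> r\<^sup>2" "t\<^sup>2 \<le> r\<^sup>2" "s'\<^sup>2 \<le> r\<^sup>2" "u\<^sup>2 \<le> r\<^sup>2"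
    using assms by (auto intro: abs_le_square_iff[THEN iffD1])
  moreover note zero_le_power2[of s] zero_le_power2[of t] zero_le_power2[of s'] zero_le_power2[of u]
  ultimately have "((t\<^sup>2 + u\<^sup>2) / 2)\<^sup>2 + 3 / 4 * ((2 * s\<^sup>2 - t\<^sup>2) / 3 - (2 * s'\<^sup>2 - u\<^sup>2) / 3)\<^sup>2 \<le> 4 * (r\<^sup>2)\<^sup>2"
    by (intro weighted_sum_squares_le abs_leI; argo)
  moreover have "(dist (grid_a s t) (grid_b s' u))\<^sup>2 = 1 + (s - s')\<^sup>2
      + (((t\<^sup>2 + u\<^sup>2) / 2)\<^sup>2 + 3 / 4 * ((2 * s\<^sup>2 - t\<^sup>2) / 3 - (2 * s'\<^sup>2 - u\<^sup>2) / 3)\<^sup>2)"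
    unfolding grid_dist by (simp add: power2_eq_square field_simps)
  ultimately show ?thesis by (simp add: power_mult[symmetric])
qed

text \<open>Up to signs the first two coordinates differ by \<open>1 / 2 - P\<close> and
  \<open>sqrt 3 / 2 * (1 - Q)\<close> with \<open>P + 3 / 2 * Q = s\<^sup>2 + t\<^sup>2\<close>, so
  the terms linear in \<open>P\<close> and \<open>Q\<close> cancel the unshared parameters and leave
  \<open>P\<^sup>2 + 3 / 4 * Q\<^sup>2\<close>. The case of \<open>grid_a\<close> and
  \<open>grid_c\<close> is analogous.\<close>

lemma dist_grid_bc:
  assumes "\<bar>s\<bar> \<le> r" "\<bar>t\<bar> \<le> r" "\<bar>u\<bar> \<le> r" "\<bar>u'\<bar> \<le> r"
  shows "(dist (grid_b s u) (grid_c u' t))\<^sup>2 \<in> {1 + (u - u')\<^sup>2 .. 1 + (u - u')\<^sup>2 + 4 * r ^ 4}"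
proof -
  have "s\<^sup>2 \<le> r\<^sup>2" "t\<^sup>2 \<le> r\<^sup>2" "u'\<^sup>2 \<le> r\<^sup>2" "u\<^sup>2 \<le> r\<^sup>2"
    using assms by (auto intro: abs_le_square_iff[THEN iffD1])
  moreover note zero_le_power2[of s] zero_le_power2[of t] zero_le_power2[of u] zero_le_power2[of u']
  ultimately have "((u\<^sup>2 - u'\<^sup>2 + t\<^sup>2) / 2)\<^sup>2 + 3 / 4 * ((2 * s\<^sup>2 - u\<^sup>2 + u'\<^sup>2 + t\<^sup>2) / 3)\<^sup>2 \<le> 4 * (r\<^sup>2)\<^sup>2"
    by (intro weighted_sum_squares_le abs_leI; argo)
  moreover have "(dist (grid_b s u) (grid_c u' t))\<^sup>2 = 1 + (u - u')\<^sup>2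
      + (((u\<^sup>2 - u'\<^sup>2 + t\<^sup>2) / 2)\<^sup>2 + 3 / 4 * ((2 * s\<^sup>2 - u\<^sup>2 + u'\<^sup>2 + t\<^sup>2) / 3)\<^sup>2)"
    unfolding grid_dist by (simp add: power2_eq_square field_simps)
  ultimately show ?thesis by (simp add: power_mult[symmetric])
qed

lemma dist_grid_ac:
  assumes "\<bar>s\<bar> \<le> r" "\<bar>t\<bar> \<le> r" "\<bar>t'\<bar> \<le> r" "\<bar>u\<bar> \<le> r"
  shows "(dist (grid_a s t) (grid_c u t'))\<^sup>2 \<in> {1 + (t - t')\<^sup>2 .. 1 + (t - t')\<^sup>2 + 4 * r ^ 4}"
proof -
  have "s\<^sup>2 \<le> r\<^sup>2" "t\<^sup>2 \<le> r\<^sup>2" "t'\<^sup>2 \<le> r\<^sup>2" "u\<^sup>2 \<le> r\<^sup>2"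
    using assms by (auto intro: abs_le_square_iff[THEN iffD1])
  moreover note zero_le_power2[of s] zero_le_power2[of t] zero_le_power2[of t'] zero_le_power2[of u]
  ultimately have "((t\<^sup>2 - t'\<^sup>2 + u\<^sup>2) / 2)\<^sup>2 + 3 / 4 * ((2 * s\<^sup>2 - t\<^sup>2 + t'\<^sup>2 + u\<^sup>2) / 3)\<^sup>2 \<le> 4 * (r\<^sup>2)\<^sup>2"
    by (intro weighted_sum_squares_le abs_leI; argo)
  moreover have "(dist (grid_a s t) (grid_c u t'))\<^sup>2 = 1 + (t - t')\<^sup>2
      + (((t\<^sup>2 - t'\<^sup>2 + u\<^sup>2) / 2)\<^sup>2 + 3 / 4 * ((2 * s\<^sup>2 - t\<^sup>2 + t'\<^sup>2 + u\<^sup>2) / 3)\<^sup>2)"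
    unfolding grid_dist by (simp add: power2_eq_square field_simps)
  ultimately show ?thesis by (simp add: power_mult[symmetric])
qed

text \<open>A crude estimate suffices: each of the at most four nonzero squared coordinate
  differences is at most 1/16.\<close>

lemma dist_grid_same:
  assumes "0 \<le> r" "r \<le> 1 / 4" "s \<in> {0..r}" "t \<in> {0..r}" "s' \<in> {0..r}" "t' \<in> {0..r}"
  shows "(dist (grid_a s t) (grid_a s' t'))\<^sup>2 \<le> 1" (is ?A)
    and "(dist (grid_b s t) (grid_b s' t'))\<^sup>2 \<le> 1" (is ?B)
    and "(dist (grid_c s t) (grid_c s' t'))\<^sup>2 \<le> 1" (is ?C)
proof -
  have "x\<^sup>2 \<le> r" if "x \<in> {0..r}" for x
    using mult_mono[of x r x 1] that assms(2) by (simp add: power2_eq_square)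
  then have sq: "s\<^sup>2 \<le> r" "t\<^sup>2 \<le> r" "s'\<^sup>2 \<le> r" "t'\<^sup>2 \<le> r" using assms by auto
  note sq = this zero_le_power2[of s] zero_le_power2[of t] zero_le_power2[of s'] zero_le_power2[of t']
  have small: "x\<^sup>2 \<le> 1 / 16" if "\<bar>x\<bar> \<le> r" for x
    using power_mono[of "\<bar>x\<bar>" "1 / 4" 2] that assms(2) by (simp add: power_divide)
  have 1: "(s - s')\<^sup>2 \<le> 1 / 16" "(t - t')\<^sup>2 \<le> 1 / 16"
    by (rule small, use assms in force)+
  have a: "(t\<^sup>2 / 2 - t'\<^sup>2 / 2)\<^sup>2 \<le> 1 / 16"
     "((2 * s\<^sup>2 - t\<^sup>2) / 3 - (2 * s'\<^sup>2 - t'\<^sup>2) / 3)\<^sup>2 \<le> 1 / 16"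
    by (rule small, rule abs_leI; use sq in argo)+
  show ?A unfolding grid_dist using 1 a by simp
  have b: "(1 - t\<^sup>2 / 2 - (1 - t'\<^sup>2 / 2))\<^sup>2 \<le> 1 / 16"
    by (rule small, rule abs_leI; use sq in argo)
  show ?B unfolding grid_dist using 1 a(2) b by simp
  have c: "(1 / 2 + (t\<^sup>2 - s\<^sup>2) / 2 - (1 / 2 + (t'\<^sup>2 - s'\<^sup>2) / 2))\<^sup>2 \<le> 1 / 16"
     "(1 - (s\<^sup>2 + t\<^sup>2) / 3 - (1 - (s'\<^sup>2 + t'\<^sup>2) / 3))\<^sup>2 \<le> 1 / 16"
    by (rule small, rule abs_leI; use sq in argo)+
  show ?C unfolding grid_dist using 1 c by simp
qed

text \<open>Index triples start at 1, since 0 is the base value common to all cuboctahedra.\<close>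

lemma (in triangle_grid) reduced_betti_ge:
  "(m - 1) ^ 3 \<le> reduced_betti TYPE('k::field) 2 K"
proof -
  let ?I = "{1..<m} \<times> {1..<m} \<times> {1..<m}"
  have "card ?I \<le> reduced_betti TYPE('k) 2 K"
  proof (rule card_le_reduced_betti[OF fin, of ?I cuboctahedron 2 "\<lambda>(s, t, u). [a s t, b s u, c u t]"])
    fix i j assume "i \<in> ?I" "j \<in> ?I"
    then show "cuboctahedron j (case i of (s, t, u) \<Rightarrow> [a s t, b s u, c u t]) = (if i = j then 1 else 0 :: 'k)"
      by (auto simp: cuboctahedron_dual)
  qed (auto simp: cuboctahedron_cycle boundary_at_maximal_triangle)
  moreover have "card ?I = (m - 1) ^ 3" by (simp add: card_cartesian_product power3_eq_cube)
  ultimately show ?thesis by simp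
qed

section \<open>Realising the grid as a Rips complex\<close>

lemma in_rips_complex_iff:
  fixes S :: "'a::metric_space set"
  assumes "finite S"
  shows "\<sigma> \<in> rips_complex S \<longleftrightarrow> \<sigma> \<subseteq> S \<and> (\<forall>x\<in>\<sigma>. \<forall>y\<in>\<sigma>. dist x y \<le> 1)"
proof -
  have "diameter \<sigma> \<le> 1 \<longleftrightarrow> (\<forall>x\<in>\<sigma>. \<forall>y\<in>\<sigma>. dist x y \<le> 1)" if "\<sigma> \<subseteq> S"
  proof
    \<comment> \<open>\<open>diameter\<close> is a supremum, which dominates the distances only for
      bounded sets.\<close>
    have "bounded \<sigma>" using that assms finite_imp_bounded bounded_subset by blast
    then show "\<forall>x\<in>\<sigma>. \<forall>y\<in>\<sigma>. dist x y \<le> 1" if "diameter \<sigma> \<le> 1"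
      using diameter_bounded_bound that by (meson order_trans)
    show "diameter \<sigma> \<le> 1" if "\<forall>x\<in>\<sigma>. \<forall>y\<in>\<sigma>. dist x y \<le> 1"
      using that by (auto simp: diameter_def intro!: cSUP_least)
  qed
  then show ?thesis by (auto simp: rips_complex_def)
qed

lemma Union_rips_complex:
  assumes "finite S"
  shows "\<Union>(rips_complex S) = S"
proof -
  have "{x} \<in> rips_complex S" if "x \<in> S" for x
    using that by (simp add: in_rips_complex_iff[OF assms])
  then show ?thesis unfolding rips_complex_def by blast
qed

lemma ex_rips_grid:
  assumes "m > 0"
  obtains S :: "(real ^ 5) set"
  where "finite S" "card S \<le> 3 * m\<^sup>2"
    "(m - 1) ^ 3 \<le> reduced_betti TYPE('k::field) 2 (rips_complex S)"
proof -
  \<comment> \<open>Nested pairs are convenient for coordinates; a linear isometry carries them to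
    \<open>real ^ 5\<close>.\<close>
  have "DIM(real \<times> real \<times> real \<times> real \<times> real) = DIM(real ^ 5)" by simp
  then obtain f :: "real \<times> real \<times> real \<times> real \<times> real \<Rightarrow> real ^ 5" where
    f: "linear f" "\<And>x. norm (f x) = norm x"
    using isomorphisms_UNIV_UNIV by metis
  \<comment> \<open>Parameters are multiples of the spacing \<open>\<epsilon>\<close> and bounded by
    \<open>r\<close>, which is \<open>m * \<epsilon>\<close>. With \<open>\<epsilon>\<close> of
    order \<open>1 / m\<^sup>2\<close> the error \<open>4 * r ^ 4\<close> is
    \<open>\<epsilon>\<^sup>2 / 4\<close>. Squared distances between families are then at most
    \<open>1 + \<epsilon>\<^sup>2 / 4\<close> if the shared indices agree and at least
    \<open>1 + \<epsilon>\<^sup>2\<close> otherwise; the threshold \<open>\<rho>\<^sup>2\<close>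
    lies in between, and scaling by \<open>1 / \<rho>\<close> moves it to 1.\<close>
  define r where "r = 1 / (4 * real m)"
  define \<epsilon> where "\<epsilon> = 1 / (4 * (real m)\<^sup>2)"
  define \<rho> where "\<rho> = sqrt (1 + \<epsilon>\<^sup>2 / 2)"
  define e where "e s = \<epsilon> * real s" for s
  define g where "g x = (1 / \<rho>) *\<^sub>R f x" for x
  have \<epsilon>: "\<epsilon> > 0" using assms by (simp add: \<epsilon>_def)
  have \<rho>: "\<rho>\<^sup>2 = 1 + \<epsilon>\<^sup>2 / 2" by (simp add: \<rho>_def)
  have \<rho>_pos: "\<rho> > 0" using zero_le_power2[of \<epsilon>] unfolding \<rho>_def by (intro real_sqrt_gt_zero) linarith
  have r: "0 \<le> r" "r \<le> 1 / 4" "r = \<epsilon> * real m"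
    using assms by (simp_all add: r_def \<epsilon>_def power2_eq_square field_simps)
  have "4 * r ^ 4 = \<epsilon>\<^sup>2 / 4"
    using assms by (simp add: r_def \<epsilon>_def power2_eq_square power4_eq_xxxx field_simps)
  then have r4: "4 * r ^ 4 \<le> \<epsilon>\<^sup>2 / 2" using zero_le_power2[of \<epsilon>] by linarith
  have e: "e s \<in> {0..r}" "\<bar>e s\<bar> \<le> r" if "s < m" for s
    using that \<epsilon> by (auto simp: e_def r(3) abs_mult)
  have e_eq: "e s = e s' \<longleftrightarrow> s = s'" for s s' using \<epsilon> by (simp add: e_def)
  have dist_g: "dist (g x) (g y) = dist x y / \<rho>" for x y
  proof -
    have "g x - g y = (1 / \<rho>) *\<^sub>R f (x - y)"
      by (simp add: g_def linear_diff[OF f(1)] scaleR_diff_right)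
    then show ?thesis using \<rho>_pos by (simp add: dist_norm f(2))
  qed
  have dist_g_le: "dist (g x) (g y) \<le> 1 \<longleftrightarrow> (dist x y)\<^sup>2 \<le> \<rho>\<^sup>2" for x y
    using \<rho>_pos by (simp add: dist_g abs_le_square_iff[symmetric])
  have g_eq: "g x = g y \<longleftrightarrow> x = y" for x y
    using dist_g[of x y] \<rho>_pos by (metis dist_eq_0_iff divide_eq_0_iff less_irrefl)
  have adj: "dist (g x) (g y) \<le> 1 \<longleftrightarrow> s = s'" and neq: "g x \<noteq> g y"
    if "(dist x y)\<^sup>2 \<in> {1 + (e s - e s')\<^sup>2 .. 1 + (e s - e s')\<^sup>2 + 4 * r ^ 4}" for x y s s'
  proof -
    have "\<epsilon>\<^sup>2 \<le> (e s - e s')\<^sup>2" if "s \<noteq> s'"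
    proof -
      have "1 \<le> \<bar>real s - real s'\<bar>" using that by linarith
      then have "\<epsilon> * 1 \<le> \<epsilon> * \<bar>real s - real s'\<bar>" using \<epsilon> by (intro mult_left_mono) auto
      also have "\<dots> = \<bar>e s - e s'\<bar>" using \<epsilon> by (simp add: e_def abs_mult flip: right_diff_distrib)
      finally show ?thesis using \<epsilon> by (simp flip: abs_le_square_iff)
    qed
    moreover have "\<epsilon>\<^sup>2 > 0" using \<epsilon> by simp
    ultimately have "\<not> (dist x y)\<^sup>2 \<le> \<rho>\<^sup>2" if "s \<noteq> s'"
      using that \<open>(dist x y)\<^sup>2 \<in> _\<close> unfolding \<rho> atLeastAtMost_iff by linarith
    then show "dist (g x) (g y) \<le> 1 \<longleftrightarrow> s = s'"
      using that r4 unfolding dist_g_le \<rho> by (cases "s = s'") auto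
    have "(dist x y)\<^sup>2 \<noteq> 0" using that zero_le_power2[of "e s - e s'"] unfolding atLeastAtMost_iff by linarith
    then show "g x \<noteq> g y" by (auto simp: g_eq)
  qed
  have near: "dist (g x) (g y) \<le> 1" if "(dist x y)\<^sup>2 \<le> 1" for x y
    using that zero_le_power2[of \<epsilon>] unfolding dist_g_le \<rho> by linarith
  define a where "a s t = g (grid_a (e s) (e t))" for s t
  define b where "b s u = g (grid_b (e s) (e u))" for s u
  define c where "c u t = g (grid_c (e u) (e t))" for u t
  have eqs: "a i j = a k l \<longleftrightarrow> i = k \<and> j = l" "b i j = b k l \<longleftrightarrow> i = k \<and> j = l"
    "c i j = c k l \<longleftrightarrow> i = k \<and> j = l" for i j k l
    unfolding a_def b_def c_def g_eq grid_a_def grid_b_def grid_c_def prod.inject e_eq by blast+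
  have ab: "dist (a s t) (b s' u) \<le> 1 \<longleftrightarrow> s = s'" "a s t \<noteq> b s' u"
    if "s < m" "t < m" "s' < m" "u < m" for s t s' u
    using adj[OF dist_grid_ab[OF that[THEN e(2)]]] neq[OF dist_grid_ab[OF that[THEN e(2)]]]
    unfolding a_def b_def by blast+
  have ac: "dist (a s t) (c u t') \<le> 1 \<longleftrightarrow> t = t'" "a s t \<noteq> c u t'"
    if "s < m" "t < m" "u < m" "t' < m" for s t u t'
    using adj[OF dist_grid_ac[OF that(1,2,4,3)[THEN e(2)]]] neq[OF dist_grid_ac[OF that(1,2,4,3)[THEN e(2)]]]
    unfolding a_def c_def by blast+
  have bc: "dist (b s u) (c u' t) \<le> 1 \<longleftrightarrow> u = u'" "b s u \<noteq> c u' t"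
    if "s < m" "u < m" "u' < m" "t < m" for s u u' t
    using adj[OF dist_grid_bc[OF that(1,4,2,3)[THEN e(2)]]] neq[OF dist_grid_bc[OF that(1,4,2,3)[THEN e(2)]]]
    unfolding b_def c_def by blast+
  have same: "dist (a s t) (a s' t') \<le> 1" "dist (b s t) (b s' t') \<le> 1" "dist (c s t) (c s' t') \<le> 1"
    if "s < m" "t < m" "s' < m" "t' < m" for s t s' t'
    unfolding a_def b_def c_def
    by (intro near dist_grid_same[OF r(1,2)] that[THEN e(1)])+
  have comm: "dist (b i j) (a k l) = dist (a k l) (b i j)" "dist (c i j) (a k l) = dist (a k l) (c i j)"
    "dist (c i j) (b k l) = dist (b k l) (c i j)" for i j k l
    by (rule dist_commute)+
  define S where "S = case_prod a ` ({..<m} \<times> {..<m}) \<union> case_prod b ` ({..<m} \<times> {..<m})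
    \<union> case_prod c ` ({..<m} \<times> {..<m})"
  have S: "finite S" unfolding S_def by simp
  have card_image: "card (case_prod h ` ({..<m} \<times> {..<m})) \<le> m\<^sup>2" for h :: "nat \<Rightarrow> nat \<Rightarrow> real ^ 5"
    using card_image_le[of "{..<m} \<times> {..<m}" "case_prod h"]
    by (simp add: card_cartesian_product power2_eq_square)
  have "card S \<le> 3 * m\<^sup>2"
    unfolding S_def using card_image[of a] card_image[of b] card_image[of c]
    by (intro order_trans[OF card_Un_le] order_trans[OF add_mono[OF card_Un_le order_refl]]) simp
  have mem: "a s t \<in> S" "b s t \<in> S" "c s t \<in> S" if "s < m" "t < m" for s t
    using that unfolding S_def by auto
  note face = in_rips_complex_iff[OF S]
  interpret triangle_grid "rips_complex S" m a b c
  proof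
    show "finite (\<Union>(rips_complex S))" using S by (simp add: Union_rips_complex)
  next
    fix s t u v
    assume less: "s < m" "t < m" "u < m"
      and v: "insert v {a s t, b s u, c u t} \<in> rips_complex S"
    then have "v \<in> S" and d: "dist v (a s t) \<le> 1" "dist v (b s u) \<le> 1" "dist v (c u t) \<le> 1"
      by (simp_all add: face)
    from \<open>v \<in> S\<close> consider i j where "i < m" "j < m" "v = a i j" | i j where "i < m" "j < m" "v = b i j"
      | i j where "i < m" "j < m" "v = c i j"
      unfolding S_def by auto
    \<comment> \<open>Adjacency to the two vertices of the other families forces both indices of
      \<open>v\<close>.\<close>
    then show "v \<in> {a s t, b s u, c u t}"
      using d less by cases (simp_all add: ab(1) ac(1) bc(1) comm)
  qed (simp_all add: face mem ab ac bc same comm eqs)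
  show thesis using that[OF S \<open>card S \<le> 3 * m\<^sup>2\<close> reduced_betti_ge] .
qed

section \<open>The asymptotic bound\<close>

lemma reduced_betti_le_max_rips_betti:
  fixes S :: "(real ^ 'd::finite) set"
  assumes "finite S" "card S \<le> n"
  shows "reduced_betti TYPE('k::field) p (rips_complex S) \<le> max_rips_betti TYPE('k) TYPE('d) p n"
proof -
  let ?B = "{reduced_betti TYPE('k) p (rips_complex S) | S :: (real ^ 'd) set. finite S \<and> card S \<le> n}"
  \<comment> \<open>\<open>Max\<close> bounds the members only of a finite set, which is what the
    crude upper bound on Betti numbers provides.\<close>
  have "?B \<subseteq> {..n ^ (p + 1)}"
  proof safe
    fix S :: "(real ^ 'd) set" assume S: "finite S" "card S \<le> n"
    then have "reduced_betti TYPE('k) p (rips_complex S) \<le> card S ^ (p + 1)"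
      using reduced_betti_le[of "rips_complex S"] by (simp add: Union_rips_complex)
    also have "\<dots> \<le> n ^ (p + 1)" using S(2) by (intro power_mono) auto
    finally show "reduced_betti TYPE('k) p (rips_complex S) \<le> n ^ (p + 1)" .
  qed
  then have "finite ?B" by (rule finite_subset) simp
  then show ?thesis unfolding max_rips_betti_def using assms by (intro Max_ge) auto
qed

theorem theorem4p7:
  shows "\<exists>C>0. \<forall>\<^sub>F n in sequentially.
    real (max_rips_betti TYPE('k::field) TYPE(5) 2 n) > C * real n powr (3 / 2)"
proof (intro exI conjI)
  show "\<forall>\<^sub>F n in sequentially.
    real (max_rips_betti TYPE('k) TYPE(5) 2 n) > 1 / 64 * real n powr (3 / 2)"
    \<comment> \<open>For \<open>n \<ge> 64\<close>, \<open>sqrt n\<close> is at least 8, so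
      \<open>m - 1 > sqrt n / 2 - 2 \<ge> sqrt n / 4\<close>; cubing gives the constant
      1/64.\<close>
    using eventually_ge_at_top[of 64]
  proof eventually_elim
    case (elim n)
    define x where "x = sqrt (real n)"
    have x: "x \<ge> 8" unfolding x_def using elim by (intro real_le_rsqrt) simp
    have x2: "x\<^sup>2 = real n" by (simp add: x_def)
    \<comment> \<open>Half of \<open>sqrt n\<close> keeps the number of points, at most
      \<open>3 * m\<^sup>2\<close>, below \<open>3 / 4 * n\<close>.\<close>
    define m where "m = nat \<lfloor>x / 2\<rfloor>"
    have m: "real m \<le> x / 2" "x / 2 < real m + 1" using x unfolding m_def by linarith+
    have "m > 0" using m(2) x by (cases m) auto
    then obtain S :: "(real ^ 5) set" where S: "finite S" "card S \<le> 3 * m\<^sup>2"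
      "(m - 1) ^ 3 \<le> reduced_betti TYPE('k) 2 (rips_complex S)"
      by (rule ex_rips_grid)
    have "real (3 * m\<^sup>2) \<le> 3 * (x / 2)\<^sup>2" using m(1) by (simp add: power_mono)
    also have "\<dots> \<le> real n" by (simp add: power_divide x2)
    finally have "card S \<le> n" using S(2) by linarith
    have "1 / 64 * real n powr (3 / 2) = (x / 4) ^ 3"
    proof -
      have "real n powr (3 / 2) = (real n powr (1 / 2)) powr 3" by (simp add: powr_powr)
      also have "\<dots> = x ^ 3" using x by (simp add: powr_half_sqrt x_def)
      finally show ?thesis by (simp add: power_divide)
    qed
    also have "\<dots> < (real m - 1) ^ 3" using m x by (intro power_strict_mono) auto
    also have "\<dots> = real ((m - 1) ^ 3)" using \<open>m > 0\<close> by (simp add: of_nat_diff)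
    also have "\<dots> \<le> real (max_rips_betti TYPE('k) TYPE(5) 2 n)"
      using S(3) reduced_betti_le_max_rips_betti[OF S(1) \<open>card S \<le> n\<close>, of 2, where 'k = 'k] by simp
    finally show ?case .
  qed
qed simp

end
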